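(* (1) $t(P_5)=t(C_5)=t(P_6)=t(C_6)=5$. (2) $t(P_7)=t(C_7)=t(P_8)=t(C_8)=t(P_9)=t(C_9)=t(P_{10})=6$.
   Context: $P_n$ and $C_n$ denote the path and the cycle on $n$ vertices. For a finite simple graph $G$, a $G$-CFF$(t,|V(G)|)$ is a family of subsets $B_v\subseteq[1,t]=\{1,\dots,t\}$, one for each vertex $v$, such that for every edge $\{a,b\}$: (i) $B_a\not\subseteq B_b$ and $B_b\not\subseteq B_a$, and (ii) for every vertex $w\notin\{a,b\}$, $B_w\not\subseteq B_a\cup B_b$. $t(G)$ is the minimum $t$ for which a $G$-CFF$(t,|V(G)|)$ exists. *)

theory Defs
  imports "Graph_Theory.Pair_Digraph"
begin

text \<open>
  A finite simple graph is a \<^locale>\<open>pair_graph\<close>: a finite, loop-free, symmetric digraph whose arcs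
  are pairs of vertices. An undirected edge is a pair of opposite arcs.
\<close>

definition path_graph :: "nat \<Rightarrow> nat pair_pre_digraph" where
  "path_graph n =
    \<lparr> pverts = {..<n}, parcs = {(i, j). i < n \<and> j < n \<and> (j = i + 1 \<or> i = j + 1)} \<rparr>"

text \<open>
  The cycle on \<open>n\<close> vertices, meaningful for \<open>n \<ge> 3\<close> only.
\<close>

definition cycle_graph :: "nat \<Rightarrow> nat pair_pre_digraph" where
  "cycle_graph n =
    \<lparr> pverts = {..<n},
      parcs = {(i, j). i < n \<and> j < n \<and> (j = (i + 1) mod n \<or> i = (j + 1) mod n)} \<rparr>"

text \<open>
  \<open>graph_cff G t B\<close>: the blocks \<open>B v\<close>, for \<open>v\<close> a vertex of \<open>G\<close>, form a \<open>G\<close>-CFF\<open>(t, |V(G)|)\<close>. The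
  second parameter of the notation is determined by \<open>G\<close>. The family is indexed, so a priori two
  vertices may carry the same block; values of \<open>B\<close> outside the vertex set are irrelevant.
\<close>

definition graph_cff :: "'a pair_pre_digraph \<Rightarrow> nat \<Rightarrow> ('a \<Rightarrow> nat set) \<Rightarrow> bool" where
  "graph_cff G t B \<longleftrightarrow>
    (\<forall>v \<in> pverts G. B v \<subseteq> {1..t}) \<and>
    (\<forall>(a, b) \<in> parcs G.
       \<not> B a \<subseteq> B b \<and> \<not> B b \<subseteq> B a \<and>
       (\<forall>w \<in> pverts G - {a, b}. \<not> B w \<subseteq> B a \<union> B b))"

definition cff_number :: "'a pair_pre_digraph \<Rightarrow> nat" where
  "cff_number G = (LEAST t. \<exists>B. graph_cff G t B)"

lemma pair_graph_path_graph: "pair_graph (path_graph n)"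
proof -
  have fin: "finite {(i, j). i < n \<and> j < n \<and> (j = i + 1 \<or> i = j + 1)}"
    by (rule finite_subset[of _ "{..<n} \<times> {..<n}"]) auto
  show ?thesis
    by unfold_locales
      (use fin in \<open>auto simp: path_graph_def symmetric_def arcs_ends_def arc_to_ends_def
        with_proj_def intro!: symI\<close>)
qed

lemma pair_graph_cycle_graph:
  assumes "n \<ge> 3"
  shows "pair_graph (cycle_graph n)"
proof -
  have fin: "finite {(i, j). i < n \<and> j < n \<and> (j = (i + 1) mod n \<or> i = (j + 1) mod n)}"
    by (rule finite_subset[of _ "{..<n} \<times> {..<n}"]) auto
  have neq: "Suc i mod n \<noteq> i" if "i < n" for i
    using that assms by (cases "Suc i = n") auto
  show ?thesis
    by unfold_locales
      (use fin neq neq[symmetric] in \<open>auto simp: cycle_graph_def symmetric_def arcs_ends_def arc_to_ends_def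
        with_proj_def intro!: symI\<close>)
qed

text \<open>
  Distinct singletons form a CFF, so the minimum defining \<^const>\<open>cff_number\<close> is attained.
\<close>

lemma graph_cff_exists:
  assumes "pair_graph G"
  shows "\<exists>t B. graph_cff G t B"
proof -
  interpret pair_graph G by fact
  obtain f :: "'a \<Rightarrow> nat" where f: "bij_betw f (pverts G) {0..<card (pverts G)}"
    using ex_bij_betw_finite_nat[OF pair_finite_verts] by blast
  have inj: "f x = f y \<longleftrightarrow> x = y" if "x \<in> pverts G" "y \<in> pverts G" for x y
    using f that by (auto simp: bij_betw_def inj_on_def)
  have range: "f v < card (pverts G)" if "v \<in> pverts G" for v
    using f that by (auto simp: bij_betw_def)
  have arc: "a \<in> pverts G" "b \<in> pverts G" "a \<noteq> b" if "(a, b) \<in> parcs G" for a b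
    using arc_fst_in_verts[OF that] arc_snd_in_verts[OF that] pair_no_loops[OF that] by simp_all
  have "graph_cff G (card (pverts G)) (\<lambda>v. {Suc (f v)})"
    unfolding graph_cff_def using range arc inj by (fastforce simp: Suc_le_eq)
  then show ?thesis by blast
qed

lemma cff_number_attained:
  assumes "pair_graph G"
  shows "\<exists>B. graph_cff G (cff_number G) B"
  unfolding cff_number_def by (rule LeastI_ex) (rule graph_cff_exists[OF assms])

end

theory Submission
  imports Defs
begin

text \<open>
  The lower bounds come from the two paths \<open>P\<^sub>5\<close> and \<open>P\<^sub>7\<close>, since CFFs restrict to subgraphs. In a CFF of a
  path the blocks form an antichain. Five blocks in an antichain on four points are 2-subsets, and the
  unions along three edges then leave too little room; this excludes \<open>P\<^sub>5\<close> on four points. For \<open>P\<^sub>7\<close> on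
  five points, a singleton block, or an edge whose union has four points, allows one to delete a
  point and reduce to that case. Otherwise all blocks are pairs and all edge unions are triples
  containing exactly two blocks, which a double count excludes.
\<close>

section \<open>Upper bounds\<close>

lemma graph_cff_mono:
  assumes "graph_cff H t B" "pverts G \<subseteq> pverts H" "parcs G \<subseteq> parcs H" "t \<le> u"
  shows "graph_cff G u B"
  unfolding graph_cff_def
proof (intro conjI ballI)
  fix v assume "v \<in> pverts G"
  then have "B v \<subseteq> {1..t}" using assms(1,2) unfolding graph_cff_def by auto
  then show "B v \<subseteq> {1..u}" using assms(4) by auto
next
  fix e assume e: "e \<in> parcs G"
  obtain a b where ab: "e = (a, b)" by (cases e)
  have abH: "(a, b) \<in> parcs H" using e ab assms(3) by auto
  have "\<not> B a \<subseteq> B b \<and> \<not> B b \<subseteq> B a \<and> (\<forall>w\<in>pverts H - {a, b}. \<not> B w \<subseteq> B a \<union> B b)"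
    using bspec[OF conjunct2[OF assms(1)[unfolded graph_cff_def]] abH] by simp
  then show "case e of (a, b) \<Rightarrow> \<not> B a \<subseteq> B b \<and> \<not> B b \<subseteq> B a \<and>
      (\<forall>w\<in>pverts G - {a, b}. \<not> B w \<subseteq> B a \<union> B b)"
    using assms(2) unfolding ab by (auto simp del: Un_subset_iff)
qed

lemma cff_number_le: "graph_cff G t B \<Longrightarrow> cff_number G \<le> t"
  unfolding cff_number_def by (blast intro: Least_le)

lemma cff_number_mono:
  assumes "pair_graph H" "pverts G \<subseteq> pverts H" "parcs G \<subseteq> parcs H"
  shows "cff_number G \<le> cff_number H"
  using cff_number_attained[OF assms(1)] graph_cff_mono[OF _ assms(2,3) order_refl] cff_number_le
  by blast

text \<open>A CFF on fewer than \<open>t\<close> points is also one on \<open>t\<close> points, so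
  excluding the single value \<open>t\<close> excludes all smaller ones.\<close>

lemma cff_number_ge:
  assumes "pair_graph G" "\<And>B. \<not> graph_cff G t B"
  shows "Suc t \<le> cff_number G"
  using cff_number_attained[OF assms(1)] graph_cff_mono[OF _ order_refl order_refl] assms(2)
  by (meson not_less_eq_eq)

lemma cff_number_path_mono: "m \<le> n \<Longrightarrow> cff_number (path_graph m) \<le> cff_number (path_graph n)"
  by (rule cff_number_mono[OF pair_graph_path_graph]) (auto simp: path_graph_def)

lemma cff_number_path_le_cycle:
  "n \<ge> 3 \<Longrightarrow> cff_number (path_graph n) \<le> cff_number (cycle_graph n)"
  by (rule cff_number_mono[OF pair_graph_cycle_graph]) (auto simp: path_graph_def cycle_graph_def)

section \<open>Explicit families on five and six points\<close>

text \<open>Blocks come as a list and conditions as bounded \<open>list_all\<close> checks, so that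
  \<open>simp\<close> decides them for a concrete \<open>bs\<close>.\<close>

lemma cff_number_path_le:
  assumes "list_all (\<lambda>i. set (bs ! i) \<subseteq> {1..t}) [0..<n]"
    and "list_all (\<lambda>i. list_all (\<lambda>w. w \<noteq> i \<longrightarrow> \<not> set (bs ! w) \<subseteq> set (bs ! i)) [0..<n]) [0..<n]"
    and "list_all (\<lambda>i. list_all (\<lambda>w. w \<noteq> i \<and> w \<noteq> i + 1 \<longrightarrow>
           \<not> set (bs ! w) \<subseteq> set (bs ! i) \<union> set (bs ! (i + 1))) [0..<n]) [0..<n - 1]"
  shows "cff_number (path_graph n) \<le> t"
proof (rule cff_number_le)
  have E: "\<not> set (bs ! w) \<subseteq> set (bs ! i) \<union> set (bs ! (i + 1))"
    if "i + 1 < n" "w < n" "w \<noteq> i" "w \<noteq> i + 1" for i w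
    using assms(3) that by (auto simp: list_all_iff)
  \<comment> \<open>The hypothesis checks each edge once, from \<open>i\<close> to
    \<open>i + 1\<close>; the arcs run both ways.\<close>
  have E': "\<not> set (bs ! w) \<subseteq> set (bs ! (i + 1)) \<union> set (bs ! i)"
    if "i + 1 < n" "w < n" "w \<noteq> i" "w \<noteq> i + 1" for i w
    using E[OF that] by (simp add: Un_commute)
  have A: "\<not> set (bs ! w) \<subseteq> set (bs ! i)" if "i < n" "w < n" "w \<noteq> i" for i w
    using assms(2) that by (auto simp: list_all_iff)
  have arc: "\<not> set (bs ! a) \<subseteq> set (bs ! b) \<and> \<not> set (bs ! b) \<subseteq> set (bs ! a) \<and>
      (\<forall>w\<in>{..<n} - {a, b}. \<not> set (bs ! w) \<subseteq> set (bs ! a) \<union> set (bs ! b))"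
    if "a < n" "b < n" "b = a + 1 \<or> a = b + 1" for a b
  proof -
    have "a \<noteq> b" using that by auto
    moreover have "\<not> set (bs ! w) \<subseteq> set (bs ! a) \<union> set (bs ! b)"
      if "w < n" "w \<noteq> a" "w \<noteq> b" for w
      using E[of a w] E'[of b w] that \<open>a < n\<close> \<open>b < n\<close> \<open>b = a + 1 \<or> a = b + 1\<close> by metis
    ultimately show ?thesis using A[OF that(1,2)] A[OF that(2,1)] by simp
  qed
  show "graph_cff (path_graph n) t (\<lambda>i. set (bs ! i))"
    unfolding graph_cff_def path_graph_def using assms(1) arc by (simp add: list_all_iff)
qed

lemma cff_number_cycle_le:
  assumes "2 \<le> n" "list_all (\<lambda>i. set (bs ! i) \<subseteq> {1..t}) [0..<n]"
    and "list_all (\<lambda>i. list_all (\<lambda>w. w \<noteq> i \<longrightarrow> \<not> set (bs ! w) \<subseteq> set (bs ! i)) [0..<n]) [0..<n]"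
    and "list_all (\<lambda>i. list_all (\<lambda>w. w \<noteq> i \<and> w \<noteq> (i + 1) mod n \<longrightarrow>
           \<not> set (bs ! w) \<subseteq> set (bs ! i) \<union> set (bs ! ((i + 1) mod n))) [0..<n]) [0..<n]"
  shows "cff_number (cycle_graph n) \<le> t"
proof (rule cff_number_le)
  have E: "\<not> set (bs ! w) \<subseteq> set (bs ! i) \<union> set (bs ! ((i + 1) mod n))"
    if "i < n" "w < n" "w \<noteq> i" "w \<noteq> (i + 1) mod n" for i w
    using assms(4) that by (auto simp: list_all_iff)
  have E': "\<not> set (bs ! w) \<subseteq> set (bs ! ((i + 1) mod n)) \<union> set (bs ! i)"
    if "i < n" "w < n" "w \<noteq> i" "w \<noteq> (i + 1) mod n" for i w
    using E[OF that] by (simp add: Un_commute)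
  \<comment> \<open>Here \<open>2 \<le> n\<close> enters: modulo 1 a vertex would be its own
    successor.\<close>
  have neq: "(i + 1) mod n \<noteq> i" if "i < n" for i
    using that assms(1) by (cases "Suc i = n") auto
  have A: "\<not> set (bs ! w) \<subseteq> set (bs ! i)" if "i < n" "w < n" "w \<noteq> i" for i w
    using assms(3) that by (auto simp: list_all_iff)
  have arc: "\<not> set (bs ! a) \<subseteq> set (bs ! b) \<and> \<not> set (bs ! b) \<subseteq> set (bs ! a) \<and>
      (\<forall>w\<in>{..<n} - {a, b}. \<not> set (bs ! w) \<subseteq> set (bs ! a) \<union> set (bs ! b))"
    if "a < n" "b < n" "b = (a + 1) mod n \<or> a = (b + 1) mod n" for a b
  proof -
    have "a \<noteq> b" using neq that by metis
    moreover have "\<not> set (bs ! w) \<subseteq> set (bs ! a) \<union> set (bs ! b)"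
      if "w < n" "w \<noteq> a" "w \<noteq> b" for w
      using E[of a w] E'[of b w] that \<open>a < n\<close> \<open>b < n\<close> \<open>b = (a + 1) mod n \<or> a = (b + 1) mod n\<close> by metis
    ultimately show ?thesis using A[OF that(1,2)] A[OF that(2,1)] by simp
  qed
  show "graph_cff (cycle_graph n) t (\<lambda>i. set (bs ! i))"
    unfolding graph_cff_def cycle_graph_def using assms(2) arc by (simp add: list_all_iff)
qed

text \<open>When neighbouring blocks are pairs sharing a point, their union is a triple, and among
  the blocks that are pairs it only remains to avoid the third pair of that triple.\<close>

lemma cycle_upper_bounds:
  "cff_number (cycle_graph 5) \<le> 5" "cff_number (cycle_graph 6) \<le> 5"
  "cff_number (cycle_graph 7) \<le> 6" "cff_number (cycle_graph 8) \<le> 6"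
  "cff_number (cycle_graph 9) \<le> 6"
  subgoal by (rule cff_number_cycle_le[where bs = "[[1], [2], [3], [4], [5]]"]; simp add: upt_rec)
  \<comment> \<open>The edges of the complete bipartite graph with sides \<open>{1, 5}\<close> and
    \<open>{2, 3, 4}\<close>, ordered so that neighbours share a point. It has no triangle, so no
    third pair is a block.\<close>
  subgoal by (rule cff_number_cycle_le[where
    bs = "[[1, 2], [1, 3], [1, 4], [4, 5], [3, 5], [2, 5]]"]; simp add: upt_rec)
  \<comment> \<open>The same pattern with sides \<open>{2, 6}\<close> and \<open>{3, 4, 5}\<close>;
    the singleton of the new point 1 is inserted between its last and first block.\<close>
  subgoal by (rule cff_number_cycle_le[where
    bs = "[[1], [2, 3], [2, 4], [2, 5], [5, 6], [3, 6], [4, 6]]"]; simp add: upt_rec)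
  \<comment> \<open>Neighbours share a point except \<open>{3, 5}\<close> and \<open>{2, 4}\<close>,
    whose four-point union contains no other block.\<close>
  subgoal by (rule cff_number_cycle_le[where
    bs = "[[1, 2], [1, 3], [1, 4], [1, 5], [5, 6], [3, 5], [2, 4], [2, 6]]"]; simp add: upt_rec)
  subgoal by (rule cff_number_cycle_le[where
    bs = "[[1, 2], [1, 3], [1, 4], [1, 5], [5, 6], [3, 5], [2, 5], [2, 4], [2, 6]]"]; simp add: upt_rec)
  done

text \<open>All blocks but \<open>{1, 6}\<close> are triples. Neighbouring blocks have a four-point
  union, and every other block meets the two points left over.\<close>

lemma path_upper_bound: "cff_number (path_graph 10) \<le> 6"
  by (rule cff_number_path_le[where bs = "[[1, 2, 3], [1, 2, 4], [1, 2, 5], [1, 6], [1, 3, 5],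
    [3, 4, 5], [2, 3, 5], [2, 3, 6], [2, 4, 6], [4, 5, 6]]"]; simp add: upt_rec)

section \<open>Lower bounds\<close>

text \<open>Condition (ii) for an arbitrary set of edges, separated from the antichain property and
  from the ground set, so that vertices, edges and points can be deleted independently.\<close>

definition free_family :: "('v \<Rightarrow> 'a set) \<Rightarrow> 'v set \<Rightarrow> 'v set set \<Rightarrow> bool" where
  "free_family B V F \<longleftrightarrow> (\<forall>e\<in>F. \<forall>w\<in>V - e. \<not> B w \<subseteq> \<Union> (B ` e))"

definition antichain :: "('v \<Rightarrow> 'a set) \<Rightarrow> 'v set \<Rightarrow> bool" where
  "antichain B V \<longleftrightarrow> (\<forall>v\<in>V. \<forall>w\<in>V. v \<noteq> w \<longrightarrow> \<not> B w \<subseteq> B v)"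

lemma antichain_subset: "antichain B V \<Longrightarrow> W \<subseteq> V \<Longrightarrow> antichain B W"
  unfolding antichain_def by blast

lemma free_family_subset: "free_family B V F \<Longrightarrow> W \<subseteq> V \<Longrightarrow> F' \<subseteq> F \<Longrightarrow> free_family B W F'"
  unfolding free_family_def by blast

lemma antichainD: "antichain B V \<Longrightarrow> v \<in> V \<Longrightarrow> w \<in> V \<Longrightarrow> B w \<subseteq> B v \<Longrightarrow> v = w"
  unfolding antichain_def by meson

lemma free_familyD:
  "free_family B V F \<Longrightarrow> e \<in> F \<Longrightarrow> w \<in> V \<Longrightarrow> B w \<subseteq> \<Union> (B ` e) \<Longrightarrow> w \<in> e"
  unfolding free_family_def by (meson DiffI)

lemma antichain_inj_on: "antichain B V \<Longrightarrow> inj_on B V"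
  unfolding antichain_def inj_on_def by blast

text \<open>The subsets of \<open>{a, b, c}\<close> are partitioned into the three chains
  \<open>{}, {a}, {a, b}, {a, b, c}\<close> and \<open>{b}, {b, c}\<close> and \<open>{c}, {a, c}\<close>.\<close>
lemma antichain_three_points:
  assumes "antichain B V" "card S = 3" "\<And>v. v \<in> V \<Longrightarrow> B v \<subseteq> S"
  shows "card V \<le> 3"
proof (rule ccontr)
  assume V: "\<not> card V \<le> 3"
  obtain a b c where S: "S = {a, b, c}" "a \<noteq> b" "a \<noteq> c" "b \<noteq> c"
    using assms(2) by (auto simp: card_3_iff)
  \<comment> \<open>For \<open>X \<subseteq> S\<close>, \<open>chain X\<close> numbers the chain
    through \<open>X\<close>; four blocks put two into one chain.\<close>
  define chain :: "'b set \<Rightarrow> nat" where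
    "chain X = (if b \<in> X then if a \<in> X then 0 else 1 else if c \<in> X then 2 else 0)" for X
  have "card ((chain \<circ> B) ` V) \<le> card {0, 1, 2 :: nat}"
    by (intro card_mono) (auto simp: chain_def)
  then have "\<not> inj_on (chain \<circ> B) V"
    using V by (auto dest: card_image)
  then obtain v w where vw: "v \<in> V" "w \<in> V" "v \<noteq> w" "chain (B v) = chain (B w)"
    by (auto simp: inj_on_def)
  have "X \<subseteq> Y \<longleftrightarrow> (a \<in> X \<longrightarrow> a \<in> Y) \<and> (b \<in> X \<longrightarrow> b \<in> Y) \<and> (c \<in> X \<longrightarrow> c \<in> Y)" if "X \<subseteq> S" for X Y
    using that S(1) by blast
  then have "B v \<subseteq> B w \<or> B w \<subseteq> B v"
    using assms(3)[OF vw(1)] assms(3)[OF vw(2)] vw(4) by (simp add: chain_def split: if_splits)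
  then show False
    using antichainD[OF assms(1)] vw(1-3) by metis
qed

text \<open>The empty set and \<open>S\<close> are comparable to every block. If \<open>B v\<close>
  is a singleton, all other blocks avoid its point; if it is a triple, all others contain the fourth
  point, which can be removed. Either way at least four blocks form an antichain on three
  points.\<close>

lemma antichain_four_points:
  assumes ac: "antichain B V" and S: "card S = 4" and sub: "\<And>v. v \<in> V \<Longrightarrow> B v \<subseteq> S"
    and V: "card V \<ge> 5" and v: "v \<in> V"
  shows "card (B v) = 2"
proof -
  have fin: "finite S" "finite V" using S V by (auto intro: card_ge_0_finite)
  have V': "\<not> card (V - {v}) \<le> 3" using V v fin by simp
  have ac': "antichain B (V - {v})" using ac by (rule antichain_subset) blast
  obtain w where w: "w \<in> V" "w \<noteq> v"
    using V' by (metis Diff_iff all_not_in_conv card.empty insertI1 le0)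
  have 0: "B v \<noteq> {}" using antichainD[OF ac w(1) v] w(2) by auto
  have 4: "B v \<noteq> S" using antichainD[OF ac v w(1)] w sub[OF w(1)] by auto
  have 1: "card (B v) \<noteq> 1"
  proof
    assume "card (B v) = 1"
    then obtain x where x: "B v = {x}" by (auto simp: card_1_singleton_iff)
    have "B u \<subseteq> S - {x}" if "u \<in> V - {v}" for u
      using that antichainD[OF ac _ v, of u] x sub[of u] by auto
    moreover have "card (S - {x}) = 3" using x sub[OF v] S by simp
    ultimately show False using antichain_three_points[OF ac'] V' by blast
  qed
  have 3: "card (B v) \<noteq> 3"
  proof
    assume "card (B v) = 3"
    then have "card (S - B v) = 1" using S sub[OF v] fin by (simp add: card_Diff_subset finite_subset)
    then obtain x where x: "S - B v = {x}" by (auto simp: card_1_singleton_iff)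
    have mem: "x \<in> B u" if "u \<in> V - {v}" for u
    proof (rule ccontr)
      assume "x \<notin> B u"
      then have "B u \<subseteq> B v" using x sub[of u] that by auto
      then show False using antichainD[OF ac v, of u] that by auto
    qed
    have "antichain (\<lambda>u. B u - {x}) (V - {v})"
      unfolding antichain_def
    proof (intro ballI impI notI)
      fix u w assume uw: "u \<in> V - {v}" "w \<in> V - {v}" "u \<noteq> w" "B w - {x} \<subseteq> B u - {x}"
      then have "B w \<subseteq> B u" using mem by blast
      then show False using antichainD[OF ac' uw(1,2)] uw(3) by simp
    qed
    moreover have "card (S - {x}) = 3" using x S by (subst card_Diff_singleton) auto
    moreover have "B u - {x} \<subseteq> S - {x}" if "u \<in> V - {v}" for u using that sub[of u] by blast
    ultimately show False using antichain_three_points V' by blast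
  qed
  have "finite (B v)" using sub[OF v] fin(1) by (rule finite_subset)
  then have "card (B v) \<noteq> 0" using 0 by simp
  moreover have "card (B v) < 4" using psubset_card_mono[OF fin(1), of "B v"] 4 sub[OF v] S by auto
  ultimately show ?thesis using 1 3 by linarith
qed

text \<open>At most one 2-subset \<open>m\<close> of \<open>S\<close> is not a block. The union of the two blocks of an edge has
  three points and contains three 2-subsets, one of which must be \<open>m\<close>. Only two such unions exist.\<close>
lemma no_three_edges_on_four_points:
  assumes ac: "antichain B V" and fr: "free_family B V F"
    and S: "card S = 4" and sub: "\<And>v. v \<in> V \<Longrightarrow> B v \<subseteq> S" and V: "card V \<ge> 5"
    and F: "card F \<ge> 3" "\<And>e. e \<in> F \<Longrightarrow> e \<subseteq> V \<and> card e = 2"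
  shows False
proof -
  have fin: "finite S" "finite V" using S V by (auto intro: card_ge_0_finite)
  have two: "card (B v) = 2" if "v \<in> V" for v
    by (rule antichain_four_points[OF ac S sub V that])
  define P where "P = {X. X \<subseteq> S \<and> card X = 2}"
  have finP: "finite P" unfolding P_def using fin by simp
  have "card P = 6" unfolding P_def using n_subsets[OF fin(1), of 2] S by (simp add: choose_two)
  moreover have "B ` V \<subseteq> P" using sub two by (auto simp: P_def)
  moreover have "card (B ` V) = card V" by (rule card_image[OF antichain_inj_on[OF ac]])
  ultimately have one: "card (P - B ` V) \<le> 1"
    using V fin by (simp add: card_Diff_subset)
  have missing: "\<exists>m\<in>P - B ` V. m \<subseteq> \<Union> (B ` e) \<and> card (\<Union> (B ` e)) = 3" if e: "e \<in> F" for e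
  proof -
    have eV: "e \<subseteq> V" "card e = 2" using F(2)[OF e] by auto
    then obtain a b where ab: "e = {a, b}" "a \<noteq> b" by (auto simp: card_2_iff)
    have abV: "a \<in> V" "b \<in> V" using eV ab by auto
    define U where "U = \<Union> (B ` e)"
    have U: "U = B a \<union> B b" unfolding U_def ab by simp
    have US: "U \<subseteq> S" unfolding U using sub abV by blast
    then have finU: "finite U" using fin by (blast intro: finite_subset)
    \<comment> \<open>A vertex outside \<open>e\<close> exists, and its block keeps \<open>U\<close>
      from being all of \<open>S\<close>.\<close>
    have "card (V - e) \<ge> 3" using V eV fin by (subst card_Diff_subset) (auto intro: finite_subset)
    then obtain w where w: "w \<in> V - e" by (metis card.empty ex_in_conv not_numeral_le_zero)
    then have "\<not> B w \<subseteq> U" using free_familyD[OF fr e, of w] unfolding U_def by blast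
    then have "U \<noteq> S" using sub w by blast
    then have less: "card U < 4" using US S psubset_card_mono[OF fin(1)] by (metis psubsetI)
    have "card U \<noteq> 2"
    proof
      assume "card U = 2"
      moreover have "B a \<subseteq> U" "B b \<subseteq> U" unfolding U by auto
      ultimately have "B a = U" "B b = U"
        using two abV card_subset_eq[OF finU] by metis+
      then show False using antichainD[OF ac abV] ab(2) by simp
    qed
    moreover have "card U \<ge> 2" using two[OF abV(1)] card_mono[OF finU, of "B a"] U by simp
    ultimately have U3: "card U = 3" using less by linarith
    have "card {X. X \<subseteq> U \<and> card X = 2} = 3" using n_subsets[OF finU, of 2] U3 by (simp add: choose_two)
    moreover have "card {B a, B b} \<le> 2" by (simp add: card_insert_if)
    ultimately have "\<not> {X. X \<subseteq> U \<and> card X = 2} \<subseteq> {B a, B b}"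
      by (intro notI) (drule card_mono[rotated], simp_all)
    then obtain m where m: "m \<subseteq> U" "card m = 2" "m \<notin> {B a, B b}" by blast
    \<comment> \<open>By freeness the only blocks inside \<open>U\<close> are \<open>B a\<close> and
      \<open>B b\<close>.\<close>
    have "m \<notin> B ` V"
    proof
      assume "m \<in> B ` V"
      then obtain u where u: "u \<in> V" "m = B u" by blast
      then have "u \<in> V - e" using m ab by auto
      then show False using free_familyD[OF fr e u(1)] u(2) m(1) unfolding U_def by blast
    qed
    then show ?thesis using m US U3 unfolding U_def P_def by blast
  qed
  have "F \<noteq> {}" using F by auto
  then obtain e0 where e0: "e0 \<in> F" by blast
  obtain m where m: "m \<in> P - B ` V" using missing[OF e0] by blast
  have uniq: "m' = m" if "m' \<in> P - B ` V" for m'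
    using one m that finP by (metis card_le_Suc0_iff_eq finite_Diff One_nat_def)
  have unions: "(\<lambda>e. \<Union> (B ` e)) ` F \<subseteq> (\<lambda>x. insert x m) ` (S - m)"
  proof clarify
    fix e assume e: "e \<in> F"
    then have U: "m \<subseteq> \<Union> (B ` e)" "card (\<Union> (B ` e)) = 3" using missing uniq by blast+
    have "card m = 2" using m P_def by simp
    then have "card (\<Union> (B ` e) - m) = 1"
      using U by (subst card_Diff_subset) (auto intro: finite_subset card_ge_0_finite)
    then obtain x where x: "\<Union> (B ` e) - m = {x}" by (auto simp: card_1_singleton_iff)
    then have "\<Union> (B ` e) = insert x m" using U by blast
    moreover have "x \<in> S" using x F(2)[OF e] sub by blast
    ultimately show "\<Union> (B ` e) \<in> (\<lambda>x. insert x m) ` (S - m)" using x by blast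
  qed
  have "card (S - m) = 2"
    using m S fin unfolding P_def by (subst card_Diff_subset) (auto intro: finite_subset)
  then have "card ((\<lambda>x. insert x m) ` (S - m)) \<le> 2" by (metis card_image_le fin(1) finite_Diff)
  \<comment> \<open>Distinct edges have distinct unions: a vertex whose block lies in the union of
    \<open>f\<close> belongs to \<open>f\<close>. So \<open>F\<close> has at most two
    members.\<close>
  moreover have "card ((\<lambda>e. \<Union> (B ` e)) ` F) = card F"
  proof (rule card_image, rule inj_onI)
    fix e f assume ef: "e \<in> F" "f \<in> F" "\<Union> (B ` e) = \<Union> (B ` f)"
    have "e \<subseteq> f"
    proof (rule ccontr)
      assume "\<not> e \<subseteq> f"
      then obtain a where a: "a \<in> V" "a \<notin> f" "a \<in> e" using F(2)[OF ef(1)] by blast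
      then have "B a \<subseteq> \<Union> (B ` f)" using ef(3) by blast
      then show False using free_familyD[OF fr ef(2) a(1)] a(2) by simp
    qed
    then show "e = f" using F(2)[OF ef(1)] F(2)[OF ef(2)]
      by (metis card_subset_eq card.infinite zero_neq_numeral)
  qed
  ultimately show False
    using F(1) card_mono[OF _ unions] fin by simp
qed

section \<open>Transfer to paths, and five vertices on four points\<close>

definition path_edges :: "nat \<Rightarrow> nat set set" where
  "path_edges n = (\<lambda>i. {i, i + 1}) ` {..<n - 1}"

lemma path_edges_iff: "e \<in> path_edges n \<longleftrightarrow> (\<exists>i. i + 1 < n \<and> e = {i, i + 1})"
  unfolding path_edges_def by (auto simp: less_diff_conv)

text \<open>For \<open>n \<ge> 2\<close> every vertex \<open>v\<close> lies on an edge. Condition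
  (i) separates \<open>B v\<close> from the block of its partner, and (ii) keeps all other blocks
  out of the union, hence out of \<open>B v\<close>.\<close>

lemma graph_cff_path:
  assumes "graph_cff (path_graph n) t B"
  shows "free_family B {..<n} (path_edges n)"
    and "n \<ge> 2 \<Longrightarrow> antichain B {..<n}"
    and "v < n \<Longrightarrow> B v \<subseteq> {1..t}"
proof -
  have arc: "\<not> B i \<subseteq> B (i + 1)" "\<not> B (i + 1) \<subseteq> B i"
    "\<And>w. w < n \<Longrightarrow> w \<notin> {i, i + 1} \<Longrightarrow> \<not> B w \<subseteq> B i \<union> B (i + 1)" if "i + 1 < n" for i
    using assms that unfolding graph_cff_def path_graph_def by auto
  show "free_family B {..<n} (path_edges n)"
    unfolding free_family_def
  proof (intro ballI)
    fix e w assume e: "e \<in> path_edges n" and w: "w \<in> {..<n} - e"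
    obtain i where "i + 1 < n" "e = {i, i + 1}" using e unfolding path_edges_iff by blast
    then show "\<not> B w \<subseteq> \<Union> (B ` e)" using arc(3)[of i w] w by simp
  qed
  show "v < n \<Longrightarrow> B v \<subseteq> {1..t}"
    using assms unfolding graph_cff_def path_graph_def by auto
  show "antichain B {..<n}" if n: "n \<ge> 2"
    unfolding antichain_def
  proof (intro ballI impI)
    fix v w assume vw: "v \<in> {..<n}" "w \<in> {..<n}" "v \<noteq> w"
    obtain i where i: "i + 1 < n" "v = i \<or> v = i + 1"
    proof (cases "v = 0")
      case True then show thesis using n by (intro that[of 0]) auto
    next
      case False then show thesis using vw by (intro that[of "v - 1"]) auto
    qed
    show "\<not> B w \<subseteq> B v"
    proof (cases "w \<in> {i, i + 1}")
      case True then show ?thesis using arc(1,2)[OF i(1)] i(2) vw(3) by auto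
    next
      case False then show ?thesis using arc(3)[OF i(1), of w] i(2) vw(2) by blast
    qed
  qed
qed

lemma card_path_edges: "card (path_edges n) = n - 1"
  unfolding path_edges_def by (subst card_image) (auto simp: inj_on_def doubleton_eq_iff)

lemma not_graph_cff_path_5: "\<not> graph_cff (path_graph 5) 4 B"
proof
  assume "graph_cff (path_graph 5) 4 B"
  note B = graph_cff_path[OF this]
  show False
    by (rule no_three_edges_on_four_points[OF B(2,1), of "{1..4}"])
      (use B(3) in \<open>auto simp: card_path_edges path_edges_iff\<close>)
qed

section \<open>Seven vertices on five points\<close>

text \<open>At most three of the six edges meet a given one. The three survivors supply the edges
  for the reduction to four points.\<close>

lemma path_7_delete_edge:
  assumes "i < 6"
  obtains F where "F \<subseteq> path_edges 7" "card F = 3" "\<And>e. e \<in> F \<Longrightarrow> e \<subseteq> {..<7} - {i, i + 1} \<and> card e = 2"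
proof -
  \<comment> \<open>For \<open>i = 0\<close> truncated subtraction gives \<open>i - 1 = i\<close>,
    so the removed set only gets smaller.\<close>
  define I where "I = {..<6} - {i - 1, i, i + 1}"
  define F where "F = (\<lambda>j. {j, j + 1}) ` I"
  have "card I \<ge> 3"
    using diff_card_le_card_Diff[of "{i - 1, i, i + 1}" "{..<6}"] card_insert_le_m1
    unfolding I_def by (auto simp: card_insert_if split: if_splits)
  moreover have "card F = card I"
    unfolding F_def by (rule card_image) (auto simp: inj_on_def doubleton_eq_iff)
  ultimately obtain F' where F': "F' \<subseteq> F" "card F' = 3"
    by (metis obtain_subset_with_card_n)
  have "F \<subseteq> path_edges 7" unfolding F_def I_def path_edges_def by auto
  moreover have "e \<subseteq> {..<7} - {i, i + 1} \<and> card e = 2" if "e \<in> F" for e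
    using that assms unfolding F_def I_def by auto
  ultimately show thesis using that F' by blast
qed


text \<open>Call the three 2-subsets of \<open>S\<close> outside \<open>H\<close> missing. They lie in nine incidences with the ten
  3-subsets, at least six of which are used up by the members of \<open>\<T>\<close>, containing one each. But three
  missing pairs on five points cannot be pairwise disjoint, and two intersecting ones
  force too many incidences outside \<open>\<T>\<close>.\<close>
lemma no_six_cherries_on_five_points:
  assumes S: "card S = 5" and H: "\<And>p. p \<in> H \<Longrightarrow> p \<subseteq> S \<and> card p = 2" "card H = 7"
    and T: "\<And>T. T \<in> \<T> \<Longrightarrow> T \<subseteq> S \<and> card T = 3 \<and> card {p \<in> H. p \<subseteq> T} = 2" "card \<T> \<ge> 6"
    and cover: "\<And>p. p \<in> H \<Longrightarrow> \<exists>T\<in>\<T>. p \<subseteq> T"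
  shows False
proof -
  have fin: "finite S" using S by (auto intro: card_ge_0_finite)
  define P where "P = {X. X \<subseteq> S \<and> card X = 2}"
  define Q where "Q = {X. X \<subseteq> S \<and> card X = 3}"
  define M where "M = P - H"
  define f where "f X = card {m \<in> M. m \<subseteq> X}" for X
  have finPQ: "finite P" "finite Q" "finite M" unfolding M_def P_def Q_def using fin by simp_all
  have HP: "H \<subseteq> P" using H(1) by (auto simp: P_def)
  have TQ: "\<T> \<subseteq> Q" using T(1) by (auto simp: Q_def)
  have finHT: "finite H" "finite \<T>" using HP TQ finPQ finite_subset by blast+
  have "card P = 10" unfolding P_def using n_subsets[OF fin, of 2] S by (simp add: choose_two)
  then have M3: "card M = 3" unfolding M_def using HP finHT H(2) by (simp add: card_Diff_subset)
  \<comment> \<open>Two of the three pairs in such a triple are in \<open>H\<close> and share a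
    point (a cherry); the third is missing.\<close>
  have f1: "f X = 1" if X: "X \<in> \<T>" for X
  proof -
    have X': "X \<subseteq> S" "card X = 3" "card {p \<in> H. p \<subseteq> X} = 2" using T(1)[OF X] by auto
    have finX: "finite X" using X' fin finite_subset by blast
    have "{p. p \<subseteq> X \<and> card p = 2} = {p \<in> H. p \<subseteq> X} \<union> {m \<in> M. m \<subseteq> X}"
      using X'(1) H(1) unfolding M_def P_def by blast
    moreover have "card {p. p \<subseteq> X \<and> card p = 2} = 3"
      using n_subsets[OF finX, of 2] X' by (simp add: choose_two)
    moreover have "card ({p \<in> H. p \<subseteq> X} \<union> {m \<in> M. m \<subseteq> X}) = card {p \<in> H. p \<subseteq> X} + f X"
      unfolding f_def using finHT finPQ by (intro card_Un_disjoint) (auto simp: M_def)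
    ultimately show ?thesis using X'(3) by simp
  qed
  have sub_ex: thesis if "X \<in> \<T>" "\<And>m. m \<in> M \<Longrightarrow> m \<subseteq> X \<Longrightarrow> thesis" for X thesis
  proof -
    have "{m \<in> M. m \<subseteq> X} \<noteq> {}"
      using f1[OF that(1)] unfolding f_def by (metis card.empty zero_neq_one)
    then show thesis using that(2) by blast
  qed
  have "card {X \<in> Q. m \<subseteq> X} = 3" if m: "m \<in> M" for m
  proof -
    have m': "m \<subseteq> S" "card m = 2" using m unfolding M_def P_def by auto
    have finm: "finite m" using m' fin finite_subset by blast
    have "{X \<in> Q. m \<subseteq> X} = (\<lambda>x. insert x m) ` (S - m)"
    proof (intro equalityI subsetI)
      fix X assume X: "X \<in> {X \<in> Q. m \<subseteq> X}"
      then have "card (X - m) = 1" using m' finm by (simp add: Q_def card_Diff_subset)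
      then obtain x where "X - m = {x}" by (auto simp: card_1_singleton_iff)
      then have "X = insert x m \<and> x \<in> S - m" using X unfolding Q_def by auto
      then show "X \<in> (\<lambda>x. insert x m) ` (S - m)" by blast
    qed (use m' finm in \<open>auto simp: Q_def\<close>)
    moreover have "inj_on (\<lambda>x. insert x m) (S - m)" by (auto simp: inj_on_def)
    ultimately show ?thesis using m' finm S by (simp add: card_image card_Diff_subset)
  qed
  \<comment> \<open>Double count: each of the three missing pairs lies in three triples of
    \<open>Q\<close>.\<close>
  then have "(\<Sum>X\<in>Q. f X) = 9"
    unfolding f_def using sum_multicount[of Q M "\<lambda>X m. m \<subseteq> X" 3] finPQ M3 by simp
  moreover have "(\<Sum>X\<in>Q. f X) = (\<Sum>X\<in>Q - \<T>. f X) + card \<T>"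
    using sum.subset_diff[OF TQ finPQ(2), of f] f1 by simp
  ultimately have few: "(\<Sum>X\<in>Q - \<T>. f X) \<le> 3" using T(2) by simp
  have f2: "f X \<ge> 2" if "m \<in> M" "m' \<in> M" "m \<noteq> m'" "m \<subseteq> X" "m' \<subseteq> X" for m m' X
    using card_mono[of "{m \<in> M. m \<subseteq> X}" "{m, m'}"] that finPQ unfolding f_def by auto
  have MS: "m \<subseteq> S" "card m = 2" "finite m" if "m \<in> M" for m
    using that unfolding M_def P_def by (auto intro: finite_subset[OF _ fin])
  \<comment> \<open>Three disjoint pairs would need six points.\<close>
  have "\<exists>m\<in>M. \<exists>m'\<in>M. m \<noteq> m' \<and> m \<inter> m' \<noteq> {}"
  proof (rule ccontr)
    assume "\<not> ?thesis"
    then have "card (\<Union>M) = (\<Sum>m\<in>M. card m)"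
      using MS by (intro card_Union_disjoint) (auto simp: pairwise_def disjnt_def)
    also have "\<dots> = 6" using MS M3 by simp
    finally show False using card_mono[OF fin, of "\<Union>M"] MS S by fastforce
  qed
  then obtain m1 m2 b where m12: "m1 \<in> M" "m2 \<in> M" "m1 \<noteq> m2" "b \<in> m1" "b \<in> m2" by blast
  have "\<exists>a. m = {a, b} \<and> a \<noteq> b" if "card m = 2" "b \<in> m" for m
    using that by (auto simp: card_2_iff)
  then obtain a c where m1: "m1 = {a, b}" "a \<noteq> b" and m2: "m2 = {c, b}" "c \<noteq> b"
    using MS m12 by metis
  have abc: "a \<noteq> c" "a \<in> S" "b \<in> S" "c \<in> S" using m12 MS m1 m2 by auto
  define T0 where "T0 = {a, b, c}"
  have T0: "T0 \<in> Q" "f T0 \<ge> 2"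
    using abc m1 m2 f2[OF m12(1-3), of T0] unfolding T0_def Q_def by auto
  then have T0n: "T0 \<in> Q - \<T>" using f1 by fastforce
  show False
  proof (cases "{a, c} \<in> M")
    \<comment> \<open>The missing pairs form the triangle on \<open>T0\<close>, so the complementary
      pair is in \<open>H\<close>. A member of \<open>\<T>\<close> covering it meets
      \<open>T0\<close> in one point and contains no missing pair.\<close>
    case True
    have "card {{a, b}, {c, b}, {a, c}} = 3"
      using abc m1 m2 by (auto simp: card_insert_if doubleton_eq_iff)
    then have Meq: "M = {{a, b}, {c, b}, {a, c}}"
      using True m12 m1 m2 M3 finPQ(3) by (metis card_subset_eq empty_subsetI insert_subset)
    have "card (S - T0) = 2" using T0(1) S fin unfolding Q_def
      by (auto simp: card_Diff_subset finite_subset)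
    moreover have "S - T0 \<notin> M" unfolding Meq T0_def by auto
    ultimately have "S - T0 \<in> H" unfolding M_def P_def by auto
    then obtain X where X: "X \<in> \<T>" "S - T0 \<subseteq> X" using cover by blast
    then have X': "X \<subseteq> S" "card X = 3" using T(1) by auto
    have "card (X \<inter> T0) = 1"
    proof -
      have "X \<inter> T0 = X - (S - T0)" using X' T0 by (auto simp: Q_def)
      then show ?thesis using X X' \<open>card (S - T0) = 2\<close> fin by (simp add: card_Diff_subset)
    qed
    moreover obtain m where m: "m \<in> M" "m \<subseteq> X" by (rule sub_ex[OF X(1)])
    moreover have "m \<subseteq> T0" using m(1) unfolding Meq T0_def by auto
    then have "card m \<le> card (X \<inter> T0)"
      using m(2) X' fin by (intro card_mono) (auto intro: finite_subset)
    ultimately show False using MS(2)[OF m(1)] by simp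
  next
    \<comment> \<open>A member \<open>{a, c, x}\<close> of \<open>\<T>\<close> covers
      \<open>{a, c}\<close>, and its missing pair joins \<open>x\<close> to some
      \<open>y \<in> {a, c}\<close>. Then \<open>T0\<close> and \<open>{y, b, x}\<close> each hold
      two missing pairs outside \<open>\<T>\<close>: four incidences, but only three are
      left.\<close>
    case False
    then have "{a, c} \<in> H" using abc unfolding M_def P_def by auto
    then obtain X where X: "X \<in> \<T>" "{a, c} \<subseteq> X" using cover by blast
    have X': "X \<subseteq> S" "card X = 3" using T(1)[OF X(1)] by auto
    then have "card (X - {a, c}) = 1" using X(2) abc by (simp add: card_Diff_subset)
    then obtain x where "X - {a, c} = {x}" by (auto simp: card_1_singleton_iff)
    then have x: "X = {a, c, x}" "x \<noteq> a" "x \<noteq> c" using X(2) by auto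
    have "x \<noteq> b" using x(1) X(1) T0n unfolding T0_def by (auto simp: insert_commute)
    obtain m where m: "m \<in> M" "m \<subseteq> X" by (rule sub_ex[OF X(1)])
    have "x \<in> m"
    proof (rule ccontr)
      assume "x \<notin> m"
      then have "m \<subseteq> {a, c}" using m(2) x(1) by blast
      then have "m = {a, c}" using MS(2)[OF m(1)] abc(1) by (intro card_subset_eq) auto
      then show False using False m(1) by simp
    qed
    then obtain y where "m = {x, y}" "y \<noteq> x"
      using MS(2)[OF m(1)] by (metis card_2_iff doubleton_eq_iff insertE singletonD)
    then have y: "y \<in> {a, c}" "m = {y, x}" using m(2) x(1) by auto
    have yb: "{y, b} \<in> M" using y(1) m12 m1 m2 by auto
    define T1 where "T1 = {y, b, x}"
    have "f T1 \<ge> 2" by (rule f2[OF yb m(1)]) (use y \<open>x \<noteq> b\<close> x in \<open>auto simp: T1_def doubleton_eq_iff\<close>)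
    moreover have "T1 \<in> Q" unfolding T1_def Q_def
      using y x X' abc m1 m2 \<open>x \<noteq> b\<close> by auto
    ultimately have T1: "T1 \<in> Q - \<T>" "f T1 \<ge> 2" using f1 by fastforce+
    have "T1 \<noteq> T0" unfolding T0_def T1_def using x \<open>x \<noteq> b\<close> by auto
    then have "f T0 + f T1 \<le> (\<Sum>X\<in>Q - \<T>. f X)"
      using sum_mono2[of "Q - \<T>" "{T0, T1}" f] T0n T1 finPQ by auto
    then show False using T0 T1 few by simp
  qed
qed

lemma not_graph_cff_path_7: "\<not> graph_cff (path_graph 7) 5 B"
proof
  assume "graph_cff (path_graph 7) 5 B"
  note B = graph_cff_path[OF this]
  define V where "V = {..<7 :: nat}"
  have fr: "free_family B V (path_edges 7)" and ac: "antichain B V" and sub: "\<And>v. v \<in> V \<Longrightarrow> B v \<subseteq> {1..5}"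
    using B unfolding V_def by auto
  have edge: "e \<subseteq> V \<and> card e = 2" if "e \<in> path_edges 7" for e
    using that unfolding path_edges_iff V_def by auto
  have finB: "finite (B v)" if "v \<in> V" for v using sub[OF that] finite_subset by blast
  \<comment> \<open>The antichain property keeps \<open>x\<close> out of all other blocks; deleting
    \<open>i\<close> and \<open>x\<close> leaves six blocks on four points.\<close>
  have not_single: "card (B i) \<noteq> 1" if i: "i \<in> V" for i
  proof
    assume "card (B i) = 1"
    then obtain x where x: "B i = {x}" by (auto simp: card_1_singleton_iff)
    obtain j where j: "j < 6" "i \<in> {j, j + 1}" using i unfolding V_def
      by (cases "i = 0") (auto intro: that[of 0] that[of "i - 1"])
    obtain F where F: "F \<subseteq> path_edges 7" "card F = 3" "\<And>e. e \<in> F \<Longrightarrow> e \<subseteq> V - {j, j + 1} \<and> card e = 2"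
      using path_7_delete_edge[OF j(1)] unfolding V_def by metis
    have V': "V - {i} \<subseteq> V" by blast
    show False
    proof (rule no_three_edges_on_four_points)
      show "antichain B (V - {i})" by (rule antichain_subset[OF ac V'])
      show "free_family B (V - {i}) F" by (rule free_family_subset[OF fr V' F(1)])
      show "card ({1..5} - {x}) = 4" using sub[OF i] x by simp
      show "B v \<subseteq> {1..5} - {x}" if "v \<in> V - {i}" for v
        using sub[of v] that antichainD[OF ac _ i, of v] x by auto
      show "5 \<le> card (V - {i})" using i by (simp add: V_def)
      show "3 \<le> card F" using F(2) by simp
      show "e \<subseteq> V - {i} \<and> card e = 2" if "e \<in> F" for e using F(3)[OF that] j(2) by auto
    qed
  qed
  have ne: "B i \<noteq> {}" if "i \<in> V" for i
  proof -
    have "\<exists>j\<in>V. j \<noteq> i" by (rule bexI[of _ "if i = 0 then 1 else 0"]) (auto simp: V_def)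
    then show ?thesis using antichainD[OF ac _ that] by fastforce
  qed
  have ge2: "card (B i) \<ge> 2" if "i \<in> V" for i
    using not_single[OF that] ne[OF that] finB[OF that]
    by (metis One_nat_def Suc_1 card_eq_0_iff less_Suc0 not_less_eq_eq linorder_not_le le_antisym)
  define U where "U e = \<Union> (B ` e)" for e
  have Usub: "U e \<subseteq> {1..5}" if "e \<in> path_edges 7" for e
    using edge[OF that] sub unfolding U_def by blast
  have finU: "finite (U e)" if "e \<in> path_edges 7" for e using Usub[OF that] finite_subset by blast
  \<comment> \<open>By freeness every block off \<open>e\<close> contains the one point
    \<open>x\<close> outside \<open>U e\<close>. Deleting \<open>e\<close> and \<open>x\<close>
    leaves five blocks on four points.\<close>
  have U4: "card (U e) \<noteq> 4" if e: "e \<in> path_edges 7" for e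
  proof
    assume "card (U e) = 4"
    then have "card ({1..5} - U e) = 1" using Usub[OF e] finU[OF e] by (simp add: card_Diff_subset)
    then obtain x where x: "{1..5} - U e = {x}" by (auto simp: card_1_singleton_iff)
    obtain j where j: "j < 6" "e = {j, j + 1}" using e unfolding path_edges_iff by auto
    obtain F where F: "F \<subseteq> path_edges 7" "card F = 3" "\<And>f. f \<in> F \<Longrightarrow> f \<subseteq> V - e \<and> card f = 2"
      using path_7_delete_edge[OF j(1)] unfolding V_def j(2) by metis
    have mem: "x \<in> B v" if "v \<in> V - e" for v
    proof (rule ccontr)
      assume "x \<notin> B v"
      then have "B v \<subseteq> U e" using sub[of v] that x by auto
      then show False using free_familyD[OF fr e, of v] that unfolding U_def by blast
    qed
    show False
    proof (rule no_three_edges_on_four_points)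
      show "antichain (\<lambda>v. B v - {x}) (V - e)"
        unfolding antichain_def
      proof (intro ballI impI notI)
        fix u w assume uw: "u \<in> V - e" "w \<in> V - e" "u \<noteq> w" "B w - {x} \<subseteq> B u - {x}"
        then have "B w \<subseteq> B u" using mem by blast
        then show False using antichainD[OF ac, of u w] uw by simp
      qed
      show "free_family (\<lambda>v. B v - {x}) (V - e) F"
        unfolding free_family_def
      proof (intro ballI notI)
        fix f w assume fw: "f \<in> F" "w \<in> V - e - f" "B w - {x} \<subseteq> (\<Union>v\<in>f. B v - {x})"
        obtain v where "v \<in> f" using F(3)[OF fw(1)] by fastforce
        \<comment> \<open>The union over \<open>f\<close> already contains \<open>x\<close>, so
          removing \<open>x\<close> from the blocks preserves freeness.\<close>
        then have "x \<in> \<Union> (B ` f)" using mem F(3)[OF fw(1)] by blast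
        then have "B w \<subseteq> \<Union> (B ` f)" using fw(3) by blast
        then show False using free_familyD[OF fr, of f w] fw(1,2) F(1) by blast
      qed
      show "card ({1..5} - {x}) = 4" using x by (subst card_Diff_singleton) auto
      show "B v - {x} \<subseteq> {1..5} - {x}" if "v \<in> V - e" for v using sub[of v] that by blast
      show "5 \<le> card (V - e)" using edge[OF e] by (subst card_Diff_subset) (auto simp: V_def finite_subset)
      show "3 \<le> card F" using F(2) by simp
      show "f \<subseteq> V - e \<and> card f = 2" if "f \<in> F" for f by (rule F(3)[OF that])
    qed
  qed
  have U3: "card (U e) \<le> 3" if e: "e \<in> path_edges 7" for e
  proof -
    have "card (V - e) \<noteq> 0" using edge[OF e] by (subst card_Diff_subset) (auto simp: V_def finite_subset)
    then obtain w where w: "w \<in> V - e" by (metis all_not_in_conv card.empty)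
    then have "\<not> B w \<subseteq> U e" using free_familyD[OF fr e, of w] unfolding U_def by blast
    then have "U e \<subset> {1..5}" using sub[of w] w Usub[OF e] by blast
    then have "card (U e) < 5" using psubset_card_mono[of "{1..5}" "U e"] by simp
    then show ?thesis using U4[OF e] by simp
  qed
  have inE: "\<exists>e\<in>path_edges 7. v \<in> e" if "v \<in> V" for v
    using that unfolding path_edges_def V_def
    by (cases "v = 0") (auto intro: bexI[of _ "v - 1"])
  \<comment> \<open>Strictness forces all sizes: blocks have at least two points and unions at most
    three.\<close>
  have proper: "B v \<subset> U e" if e: "e \<in> path_edges 7" "v \<in> e" for e v
  proof -
    obtain w where w: "w \<in> e" "w \<noteq> v" using edge[OF e(1)] e(2)
      by (metis card_2_iff' )
    then have "\<not> B w \<subseteq> B v" using antichainD[OF ac, of v w] edge[OF e(1)] e(2) by auto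
    then show ?thesis using w e(2) unfolding U_def by blast
  qed
  have two: "card (B v) = 2" if v: "v \<in> V" for v
  proof -
    obtain e where e: "e \<in> path_edges 7" "v \<in> e" using inE[OF v] by blast
    then have "card (B v) < card (U e)" using proper finU psubset_card_mono by metis
    then show ?thesis using U3[OF e(1)] ge2[OF v] by simp
  qed
  have three: "card (U e) = 3" if e: "e \<in> path_edges 7" for e
  proof -
    have "e \<noteq> {}" using edge[OF e] by auto
    then obtain v where v: "v \<in> e" "v \<in> V" using edge[OF e] by blast
    then have "card (B v) < card (U e)" using e proper finU psubset_card_mono by metis
    then show ?thesis using U3[OF e] two[OF v(2)] by simp
  qed
  have in_U: "v \<in> e" if "e \<in> path_edges 7" "v \<in> V" "B v \<subseteq> U e" for e v
    using free_familyD[OF fr that(1,2)] that(3) unfolding U_def by blast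
  \<comment> \<open>Take the blocks for \<open>H\<close> and the edge unions for
    \<open>\<T>\<close>; freeness makes each union contain just the two blocks of its edge.\<close>
  show False
  proof (rule no_six_cherries_on_five_points)
    show "card {1..5 :: nat} = 5" by simp
    show "p \<subseteq> {1..5} \<and> card p = 2" if "p \<in> B ` V" for p using that sub two by blast
    show "card (B ` V) = 7" using card_image[OF antichain_inj_on[OF ac]] by (simp add: V_def)
    show "X \<subseteq> {1..5} \<and> card X = 3 \<and> card {p \<in> B ` V. p \<subseteq> X} = 2" if X: "X \<in> U ` path_edges 7" for X
    proof -
      obtain e where e: "e \<in> path_edges 7" "X = U e" using X by blast
      have "{p \<in> B ` V. p \<subseteq> X} = B ` e"
        using edge[OF e(1)] in_U[OF e(1)] unfolding e(2) U_def by blast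
      moreover have "card (B ` e) = 2"
        using edge[OF e(1)] antichain_inj_on[OF antichain_subset[OF ac]] by (metis card_image)
      ultimately show ?thesis using Usub three e by simp
    qed
    have "inj_on U (path_edges 7)"
    proof (rule inj_onI)
      fix e f assume ef: "e \<in> path_edges 7" "f \<in> path_edges 7" "U e = U f"
      then have "e \<subseteq> f" "f \<subseteq> e" using in_U edge proper by (metis psubsetE subset_eq)+
      then show "e = f" by blast
    qed
    then show "6 \<le> card (U ` path_edges 7)" by (simp add: card_image card_path_edges)
    show "\<exists>X\<in>U ` path_edges 7. p \<subseteq> X" if p: "p \<in> B ` V" for p
    proof -
      obtain v where v: "v \<in> V" "p = B v" using p by blast
      obtain e where e: "e \<in> path_edges 7" "v \<in> e" using inE[OF v(1)] by blast
      have "p \<subseteq> U e" using proper[OF e] v(2) by simp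
      then show ?thesis using e(1) by blast
    qed
  qed
qed

theorem theorem8p5:
  shows "(cff_number (path_graph 5) = 5 \<and> cff_number (cycle_graph 5) = 5 \<and>
          cff_number (path_graph 6) = 5 \<and> cff_number (cycle_graph 6) = 5) \<and>
         (cff_number (path_graph 7) = 6 \<and> cff_number (cycle_graph 7) = 6 \<and>
          cff_number (path_graph 8) = 6 \<and> cff_number (cycle_graph 8) = 6 \<and>
          cff_number (path_graph 9) = 6 \<and> cff_number (cycle_graph 9) = 6 \<and>
          cff_number (path_graph 10) = 6)"
proof -
  have "5 \<le> cff_number (path_graph 5)" "6 \<le> cff_number (path_graph 7)"
    using cff_number_ge[OF pair_graph_path_graph not_graph_cff_path_5]
      cff_number_ge[OF pair_graph_path_graph not_graph_cff_path_7] by simp_all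
  \<comment> \<open>The path numbers increase with length and lie below those of the cycles of equal
    length. Cycle bounds thus cap the paths up to nine vertices; the path on ten has its own
    family.\<close>
  then show ?thesis
    using cycle_upper_bounds path_upper_bound
      cff_number_path_mono[of 5 6] cff_number_path_mono[of 7 8] cff_number_path_mono[of 8 9]
      cff_number_path_mono[of 9 10] cff_number_path_le_cycle[of 5] cff_number_path_le_cycle[of 6]
      cff_number_path_le_cycle[of 7] cff_number_path_le_cycle[of 8] cff_number_path_le_cycle[of 9]
    by simp
qed

end
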